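(* For every $k\geq1$, let $[k]$ denote the generalized pattern $12\cdots k$ (no dashes). Then $$G_{[k]}(x)=\sum_{j=1}^{k-1}j\,x^jG_{[k]}(x)F_{[k]}^{j-1}(x)+x^kF_{[k]}^k(x),$$ where $F_{[k]}(x)$ is the power series determined by $F_{[k]}(x)=\sum_{j=0}^{k-1}\bigl(xF_{[k]}(x)\bigr)^j$.
   Context: A generalized pattern is a permutation of $\{1,\dots,k\}$ written as a word $\tau_1\cdots\tau_k$ in which each pair of adjacent letters may or may not be separated by a dash "-". A permutation $\pi=\pi_1\cdots\pi_n\in S_n$ contains an occurrence of $\tau$ at indices $i_1<\dots<i_k$ if $(\pi_{i_1},\dots,\pi_{i_k})$ is order-isomorphic to $(\tau_1,\dots,\tau_k)$ and $i_{j+1}=i_j+1$ whenever $\tau_j,\tau_{j+1}$ are not separated by a dash; $\pi$ avoids $\tau$ if it has no occurrence, and contains $\tau$ exactly once if it has exactly one occurrence. $1\mbox{-}3\mbox{-}2$ is the classical pattern $132$. $F_\tau(x)=\sum_{n\geq0}f_\tau(n)x^n$ with $f_\tau(n)$ the number of permutations in $S_n$ ($S_0$ = the empty permutation) avoiding both $1\mbox{-}3\mbox{-}2$ and $\tau$; $G_\tau(x)=\sum_{n\geq0}g_\tau(n)x^n$ with $g_\tau(n)$ the number of permutations in $S_n$ avoiding $1\mbox{-}3\mbox{-}2$ and containing $\tau$ exactly once. *)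

theory Defs
  imports
    "HOL-Combinatorics.Multiset_Permutations"
    "HOL-Computational_Algebra.Formal_Power_Series"
begin

text \<open>
  A generalized pattern is a pair \<open>(\<tau>, D)\<close> of a word and a set of dash positions. Positions
  are counted from 0: \<open>j \<in> D\<close> means that there is a dash between \<open>\<tau> ! j\<close> and \<open>\<tau> ! Suc j\<close>.
\<close>
type_synonym gpattern = "nat list \<times> nat set"

definition is_gpattern :: "gpattern \<Rightarrow> bool" where
  "is_gpattern P \<longleftrightarrow>
     fst P \<in> permutations_of_set {1..length (fst P)} \<and> snd P \<subseteq> {j. Suc j < length (fst P)}"

text \<open>
  An occurrence is the increasing list of its (0-based) indices; permutations in \<open>S\<^sub>n\<close> are in
  one-line notation, i.e. elements of \<open>permutations_of_set {1..n}\<close>.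
\<close>
definition occurrences :: "gpattern \<Rightarrow> nat list \<Rightarrow> nat list set" where
  "occurrences P \<pi> = (case P of (\<tau>, D) \<Rightarrow>
     {idx. length idx = length \<tau> \<and> sorted_wrt (<) idx \<and> set idx \<subseteq> {..<length \<pi>} \<and>
           (\<forall>a<length \<tau>. \<forall>b<length \<tau>. \<pi> ! (idx ! a) < \<pi> ! (idx ! b) \<longleftrightarrow> \<tau> ! a < \<tau> ! b) \<and>
           (\<forall>j. Suc j < length \<tau> \<and> j \<notin> D \<longrightarrow> idx ! Suc j = Suc (idx ! j))})"

definition avoids :: "nat list \<Rightarrow> gpattern \<Rightarrow> bool" where
  "avoids \<pi> P \<longleftrightarrow> occurrences P \<pi> = {}"

definition contains_once :: "nat list \<Rightarrow> gpattern \<Rightarrow> bool" where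
  "contains_once \<pi> P \<longleftrightarrow> card (occurrences P \<pi>) = 1"

definition pat_1_3_2 :: gpattern where
  "pat_1_3_2 = ([1, 3, 2], {0, 1})"

definition pat_incr :: "nat \<Rightarrow> gpattern" where
  "pat_incr k = ([1..<Suc k], {})"

lemma is_gpattern_pat_1_3_2: "is_gpattern pat_1_3_2"
  by (auto simp: is_gpattern_def pat_1_3_2_def permutations_of_set_def)

lemma is_gpattern_pat_incr: "is_gpattern (pat_incr k)"
  by (auto simp: is_gpattern_def pat_incr_def permutations_of_set_def)

definition f_count :: "gpattern \<Rightarrow> nat \<Rightarrow> nat" where
  "f_count P n = card {\<pi> \<in> permutations_of_set {1..n}. avoids \<pi> pat_1_3_2 \<and> avoids \<pi> P}"

definition g_count :: "gpattern \<Rightarrow> nat \<Rightarrow> nat" where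
  "g_count P n = card {\<pi> \<in> permutations_of_set {1..n}. avoids \<pi> pat_1_3_2 \<and> contains_once \<pi> P}"

definition F_gf :: "gpattern \<Rightarrow> rat fps" where
  "F_gf P = Abs_fps (\<lambda>n. of_nat (f_count P n))"

definition G_gf :: "gpattern \<Rightarrow> rat fps" where
  "G_gf P = Abs_fps (\<lambda>n. of_nat (g_count P n))"

end

theory Submission
  imports Defs
begin

text \<open>
  In a 1-3-2-avoiding word with last letter \<open>a\<close>, all letters above \<open>a\<close> precede all letters below
  \<open>a\<close>, so the word is \<open>U V a\<close> with \<open>U > a > V\<close> and \<open>U\<close>, \<open>V\<close> arbitrary avoiders. Iterating on \<open>V\<close>
  gives \<open>U\<^sub>1 \<dots> U\<^sub>j a\<^sub>j \<dots> a\<^sub>1\<close>, where \<open>a\<^sub>j < \<dots> < a\<^sub>1\<close> is exactly the last ascending run and no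
  ascending run crosses the boundary of a block \<open>U\<^sub>i\<close>. Hence the words with last run of length
  \<open>j < k\<close> contribute \<open>(x F)\<^sup>j\<close> to \<open>F\<close> and \<open>j x\<^sup>j G F\<^sup>j\<^sup>-\<^sup>1\<close> to \<open>G\<close>, while those with \<open>j = k\<close> contribute
  \<open>(x F)\<^sup>k\<close> to \<open>G\<close>; a longer last run already contains two occurrences of \<open>[k]\<close>.
\<close>

section \<open>Binary trees as codes of 1-3-2-avoiding words\<close>

datatype ptree = Leaf | Node ptree ptree

primrec nodes :: "ptree \<Rightarrow> nat" where
  "nodes Leaf = 0"
| "nodes (Node u v) = Suc (nodes u + nodes v)"

primrec last_run :: "ptree \<Rightarrow> nat" where
  "last_run Leaf = 0"
| "last_run (Node u v) = Suc (last_run v)"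

text \<open>For \<open>k \<ge> 1\<close>, meant as the number of occurrences of \<open>[k]\<close>
  in the encoded word. The last summand is the occurrence ending at the final letter, which closes a
  run of length \<open>Suc (last_run v)\<close>.\<close>

primrec runs :: "nat \<Rightarrow> ptree \<Rightarrow> nat" where
  "runs k Leaf = 0"
| "runs k (Node u v) = runs k u + runs k v + (if k \<le> Suc (last_run v) then 1 else 0)"

text \<open>\<open>Node u v\<close> encodes \<open>U V a\<close>; \<open>c\<close> shifts the letters, which start at \<open>c + 1\<close>.\<close>

primrec word :: "nat \<Rightarrow> ptree \<Rightarrow> nat list" where
  "word c Leaf = []"
| "word c (Node u v) = word (Suc (c + nodes v)) u @ word c v @ [Suc (c + nodes v)]"

text \<open>Each letter is tested in the role of 1: the larger letters after it must not descend.
  Repeated larger letters are rejected too, so the link to the pattern is made for distinct words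
  only.\<close>

primrec av132 :: "nat list \<Rightarrow> bool" where
  "av132 [] \<longleftrightarrow> True"
| "av132 (x # xs) \<longleftrightarrow> sorted_wrt (<) (filter (\<lambda>y. x < y) xs) \<and> av132 xs"

lemma length_word [simp]: "length (word c t) = nodes t"
  by (induction t arbitrary: c) auto

lemma set_word: "set (word c t) = {Suc c..c + nodes t}"
  by (induction t arbitrary: c) auto

lemma distinct_word: "distinct (word c t)"
  by (induction t arbitrary: c) (auto simp: set_word)

text \<open>The last letter reveals \<open>nodes v\<close>, hence where the word splits, and
  induction recovers both subtrees.\<close>

lemma inj_word: "word c t = word c t' \<Longrightarrow> t = t'"
proof (induction t arbitrary: c t')
  case Leaf
  then show ?case by (cases t') auto
next
  case (Node u v)
  then show ?case
    by (cases t') auto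
qed

text \<open>If the 1 of a 1-3-2 lies in \<open>us\<close>, its larger letters lie there too, so no
  occurrence straddles the boundary.\<close>

lemma av132_append:
  assumes "\<forall>x\<in>set us. \<forall>y\<in>set vs. y < x"
  shows "av132 (us @ vs) \<longleftrightarrow> av132 us \<and> av132 vs"
  using assms
proof (induction us)
  case (Cons x us)
  then have "filter (\<lambda>y. x < y) vs = []"
    by (auto simp: filter_empty_conv not_less intro: less_imp_le)
  with Cons show ?case by auto
qed simp

lemma av132_snoc_max:
  assumes "\<forall>x\<in>set vs. x < a"
  shows "av132 (vs @ [a]) \<longleftrightarrow> av132 vs"
  using assms by (induction vs) (auto simp: sorted_wrt_append)

lemma av132_word: "av132 (word c t)"
  by (induction t arbitrary: c) (auto simp: av132_append av132_snoc_max set_word)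

lemma av132_appendD: "av132 (us @ vs) \<Longrightarrow> av132 us \<and> av132 vs"
  by (induction us) (auto simp: sorted_wrt_append)

text \<open>\<open>us\<close> is the longest prefix of letters above \<open>a\<close>. The next
  letter \<open>z\<close> is below \<open>a\<close>, so a later letter above \<open>a\<close> would
  form a 1-3-2 with \<open>z\<close> as 1 and \<open>a\<close> as 2.\<close>

lemma av132_snoc_decomp:
  assumes "av132 (ys @ [a])" and "distinct (ys @ [a])"
  obtains us vs where "ys = us @ vs" "\<forall>x\<in>set us. a < x" "\<forall>x\<in>set vs. x < a"
proof
  define us where "us = takeWhile (\<lambda>x. a < x) ys"
  define vs where "vs = dropWhile (\<lambda>x. a < x) ys"
  show ys: "ys = us @ vs" by (simp add: us_def vs_def)
  show "\<forall>x\<in>set us. a < x" by (auto simp: us_def dest: set_takeWhileD)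
  show "\<forall>x\<in>set vs. x < a"
  proof (cases vs)
    case (Cons z zs)
    then have "\<not> a < z" unfolding vs_def by (simp add: dropWhile_eq_Cons_conv)
    moreover have "z \<noteq> a" using assms(2) ys Cons by auto
    ultimately have "z < a" by simp
    moreover have "av132 (z # zs @ [a])"
      using assms(1) ys Cons av132_appendD[of us "vs @ [a]"] by simp
    ultimately have "\<forall>x\<in>set zs. z < x \<longrightarrow> x < a"
      by (auto simp: sorted_wrt_append)
    then show ?thesis using Cons \<open>z < a\<close> by force
  qed simp
qed

text \<open>Since the letters fill an interval, those of \<open>us\<close> and \<open>vs\<close>
  fill the parts above and below the last letter \<open>a\<close>, so induction applies to them with
  shifts \<open>a\<close> and \<open>c\<close>.\<close>

lemma word_surj:
  assumes "av132 xs" "distinct xs" "set xs = {Suc c..c + length xs}"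
  shows "\<exists>t. nodes t = length xs \<and> word c t = xs"
  using assms
proof (induction "length xs" arbitrary: xs c rule: less_induct)
  case less
  show ?case
  proof (cases xs rule: rev_cases)
    case Nil
    then show ?thesis by (auto intro: exI[of _ Leaf])
  next
    case (snoc ys a)
    then obtain us vs where ys: "ys = us @ vs"
      and us: "\<forall>x\<in>set us. a < x" and vs: "\<forall>x\<in>set vs. x < a"
      using av132_snoc_decomp less.prems by metis
    have dist: "distinct us" "distinct vs" using less.prems(2) snoc ys by auto
    have av: "av132 us" "av132 vs"
      using less.prems(1) av132_appendD[of us "vs @ [a]"] av132_appendD[of vs "[a]"] snoc ys by auto
    have all: "set us \<union> set vs \<union> {a} = {Suc c..c + length xs}"
      using less.prems(3) snoc ys by auto
    then have a: "a \<in> {Suc c..c + length xs}" by blast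
    have mem: "x \<in> set us \<or> x \<in> set vs \<or> x = a \<longleftrightarrow> Suc c \<le> x \<and> x \<le> c + length xs" for x
      using all by (metis Un_iff atLeastAtMost_iff singletonD singletonI)
    have svs: "set vs = {Suc c..<a}"
    proof (rule set_eqI)
      show "x \<in> set vs \<longleftrightarrow> x \<in> {Suc c..<a}" for x
        using mem[of x] a us[rule_format, of x] vs[rule_format, of x] by auto
    qed
    have sus: "set us = {Suc a..c + length xs}"
    proof (rule set_eqI)
      show "x \<in> set us \<longleftrightarrow> x \<in> {Suc a..c + length xs}" for x
        using mem[of x] a us[rule_format, of x] vs[rule_format, of x] by auto
    qed
    \<comment> \<open>Counting the letters below \<open>a\<close> shows that \<open>a\<close> is
      exactly the last letter that \<open>word\<close> produces.\<close>
    have lvs: "a = Suc (c + length vs)"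
      using distinct_card[OF dist(2)] a unfolding svs by auto
    have len: "length xs = Suc (length us + length vs)" by (simp add: snoc ys)
    have "length vs < length xs" "set vs = {Suc c..c + length vs}"
      using svs lvs len by auto
    then obtain v where v: "nodes v = length vs" "word c v = vs"
      using less.hyps[of vs c] av(2) dist(2) by blast
    have "c + length xs = a + length us" using lvs len by simp
    then have "length us < length xs" "set us = {Suc a..a + length us}"
      using sus len by auto
    then obtain u where u: "nodes u = length us" "word a u = us"
      using less.hyps[of us a] av(1) dist(1) by blast
    have "nodes (Node u v) = length xs \<and> word c (Node u v) = xs"
      using u v lvs len snoc ys by simp
    then show ?thesis by blast
  qed
qed

section \<open>Agreement of \<open>av132\<close> with the pattern 1-3-2\<close>

lemma sorted_wrt_filter_nth:
  "sorted_wrt R (filter P xs) \<longleftrightarrow>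
     (\<forall>i j. i < j \<and> j < length xs \<and> P (xs ! i) \<and> P (xs ! j) \<longrightarrow> R (xs ! i) (xs ! j))"
proof (induction xs)
  case (Cons x xs)
  have split: "(\<forall>i j. Q i j) \<longleftrightarrow>
      Q 0 0 \<and> (\<forall>j. Q 0 (Suc j)) \<and> (\<forall>i. Q (Suc i) 0) \<and> (\<forall>i j. Q (Suc i) (Suc j))"
    for Q :: "nat \<Rightarrow> nat \<Rightarrow> bool"
    by (metis nat.exhaust)
  show ?case
    by (subst split) (auto simp: Cons in_set_conv_nth)
qed simp

lemma av132_nth:
  assumes "distinct xs"
  shows "av132 xs \<longleftrightarrow>
     (\<forall>i j l. i < j \<and> j < l \<and> l < length xs \<longrightarrow> \<not> (xs ! i < xs ! l \<and> xs ! l < xs ! j))"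
  using assms
proof (induction xs)
  case (Cons x xs)
  let ?B = "\<lambda>i j l. i < j \<and> j < l \<and> l < length (x # xs) \<longrightarrow>
    \<not> ((x # xs) ! i < (x # xs) ! l \<and> (x # xs) ! l < (x # xs) ! j)"
  \<comment> \<open>Of the indices \<open>i < j < l\<close> only the first can be 0, which is the
    case tested at the head of the word.\<close>
  have split: "(\<forall>i j l. ?B i j l) \<longleftrightarrow>
      (\<forall>j l. ?B 0 (Suc j) (Suc l)) \<and> (\<forall>i j l. ?B (Suc i) (Suc j) (Suc l))" (is "?L \<longleftrightarrow> ?R")
  proof
    assume R: ?R
    show ?L
    proof (intro allI)
      fix i j l
      show "?B i j l"
      proof (cases "0 < j \<and> 0 < l")
        case True
        then obtain j' l' where "j = Suc j'" "l = Suc l'" by (metis gr0_implies_Suc)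
        with R show ?thesis by (cases i) blast+
      qed auto
    qed
  qed blast
  have "sorted_wrt (<) (filter (\<lambda>y. x < y) xs) \<longleftrightarrow> (\<forall>j l. ?B 0 (Suc j) (Suc l))"
  proof -
    \<comment> \<open>Distinctness makes the ascent required by \<open>av132\<close> the same as the
      absence of a descent.\<close>
    have "xs ! j < xs ! l \<longleftrightarrow> \<not> xs ! l < xs ! j" if "j < l" "l < length xs" for j l
      using that Cons.prems by (auto simp: nth_eq_iff_index_eq not_less order_less_le)
    then show ?thesis unfolding sorted_wrt_filter_nth by fastforce
  qed
  then show ?case using Cons unfolding split by simp
qed simp

lemma avoids_132_iff:
  assumes "distinct xs"
  shows "avoids xs pat_1_3_2 \<longleftrightarrow> av132 xs"
proof -
  have "idx \<in> occurrences pat_1_3_2 xs \<longleftrightarrow> (\<exists>i j l. idx = [i, j, l] \<and> i < j \<and> j < l \<and>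
      l < length xs \<and> xs ! i < xs ! l \<and> xs ! l < xs ! j)" for idx
  proof (cases "length idx = 3")
    case True
    then obtain i j l where idx: "idx = [i, j, l]"
      by (auto simp: numeral_3_eq_3 length_Suc_conv)
    have all3: "(\<forall>a<length [1::nat,3,2]. Q a) \<longleftrightarrow> Q 0 \<and> Q 1 \<and> Q 2" for Q
      by (auto simp: less_Suc_eq numeral_2_eq_2)
    show ?thesis
      unfolding occurrences_def pat_1_3_2_def prod.case mem_Collect_eq all3 idx
      by (auto simp: less_Suc_eq)
  qed (auto simp: occurrences_def pat_1_3_2_def)
  then show ?thesis
    unfolding avoids_def av132_nth[OF assms] by blast
qed

section \<open>Occurrences of \<open>[k]\<close> and their number in an encoded word\<close>

definition windows :: "nat \<Rightarrow> nat list \<Rightarrow> nat set" where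
  "windows k xs = {i. i + k \<le> length xs \<and> sorted_wrt (<) (take k (drop i xs))}"

lemma finite_windows: "finite (windows k xs)"
  by (rule finite_subset[of _ "{..length xs}"]) (auto simp: windows_def)

lemma mem_windows_iff:
  "i \<in> windows k xs \<longleftrightarrow>
     i + k \<le> length xs \<and> (\<forall>a<k. \<forall>b<k. xs ! (i + a) < xs ! (i + b) \<longleftrightarrow> a < b)"
proof -
  have "xs ! (i + a) < xs ! (i + b) \<longleftrightarrow> a < b"
    if "\<forall>a b. a < b \<longrightarrow> b < k \<longrightarrow> xs ! (i + a) < xs ! (i + b)" "a < k" "b < k" for a b
    using that by (cases a b rule: linorder_cases) (auto dest: order.asym)
  then have "(\<forall>a b. a < b \<longrightarrow> b < k \<longrightarrow> xs ! (i + a) < xs ! (i + b)) \<longleftrightarrow>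
      (\<forall>a<k. \<forall>b<k. xs ! (i + a) < xs ! (i + b) \<longleftrightarrow> a < b)"
    by (meson order.strict_trans)
  then show ?thesis
    by (auto simp: windows_def sorted_wrt_iff_nth_less)
qed

text \<open>Without dashes the indices are consecutive, so an occurrence is fixed by its first
  index. For \<open>k = 0\<close> this fails: the empty occurrence has no first index.\<close>

lemma occurrences_pat_incr:
  assumes "k \<ge> 1"
  shows "occurrences (pat_incr k) xs = (\<lambda>i. [i..<i + k]) ` windows k xs"
proof (intro equalityI subsetI)
  fix idx assume "idx \<in> occurrences (pat_incr k) xs"
  then have idx: "length idx = k" "set idx \<subseteq> {..<length xs}"
    "\<forall>a<k. \<forall>b<k. xs ! (idx ! a) < xs ! (idx ! b) \<longleftrightarrow> a < b"
    "\<forall>j. Suc j < k \<longrightarrow> idx ! Suc j = Suc (idx ! j)"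
    by (auto simp: occurrences_def pat_incr_def simp del: upt_Suc)
  define i where "i = idx ! 0"
  have nth: "idx ! j = i + j" if "j < k" for j
    using that by (induction j) (use idx(4) in \<open>auto simp: i_def\<close>)
  have "idx ! (k - 1) < length xs"
    using idx(1,2) assms by (metis diff_less lessThan_iff less_numeral_extra(1) less_le_trans nth_mem subsetD)
  then have "i + k \<le> length xs"
    using nth[of "k - 1"] assms by linarith
  moreover have "\<forall>a<k. \<forall>b<k. xs ! (i + a) < xs ! (i + b) \<longleftrightarrow> a < b"
    using idx(3) nth by metis
  ultimately have "i \<in> windows k xs" by (simp add: mem_windows_iff)
  moreover have "idx = [i..<i + k]"
    by (rule nth_equalityI) (use idx(1) nth in auto)
  ultimately show "idx \<in> (\<lambda>i. [i..<i + k]) ` windows k xs" by blast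
next
  fix idx assume "idx \<in> (\<lambda>i. [i..<i + k]) ` windows k xs"
  then show "idx \<in> occurrences (pat_incr k) xs"
    by (auto simp: occurrences_def pat_incr_def mem_windows_iff simp del: upt_Suc)
qed

lemma card_occurrences_pat_incr:
  assumes "k \<ge> 1"
  shows "card (occurrences (pat_incr k) xs) = card (windows k xs)"
proof -
  have "inj (\<lambda>i. [i..<i + k])"
    using assms by (auto intro!: injI dest!: arg_cong[where f = hd])
  then show ?thesis
    by (simp add: occurrences_pat_incr[OF assms] card_image inj_on_subset)
qed

text \<open>A window crossing the boundary would contain a letter of \<open>us\<close> followed by
  the first letter of \<open>vs\<close>, which is smaller.\<close>

lemma windows_append:
  assumes "\<forall>x\<in>set us. \<forall>y\<in>set vs. y < x"
  shows "windows k (us @ vs) = windows k us \<union> (\<lambda>i. length us + i) ` windows k vs"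
proof -
  have "i \<in> windows k (us @ vs) \<longleftrightarrow> i \<in> windows k us \<union> (\<lambda>i. length us + i) ` windows k vs" for i
  proof -
    consider "i + k \<le> length us" "i < length us" | i' where "i = length us + i'"
      | "i < length us" "length us < i + k"
      using le_Suc_ex not_le by blast
    then show ?thesis
    proof cases
      case 3
      have "i \<notin> windows k (us @ vs)"
      proof
        assume "i \<in> windows k (us @ vs)"
        then have "length us < i + k" "i + k \<le> length us + length vs"
          and *: "\<forall>a<k. \<forall>b<k. (us @ vs) ! (i + a) < (us @ vs) ! (i + b) \<longleftrightarrow> a < b"
          using 3 by (auto simp: mem_windows_iff)
        then have "us ! i < vs ! 0"
          using 3 *[rule_format, of 0 "length us - i"] by (auto simp: nth_append)
        moreover have "vs \<noteq> []" using 3 \<open>i + k \<le> _\<close> by auto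
        then have "us ! i \<in> set us" "vs ! 0 \<in> set vs" using 3 by auto
        ultimately show False using assms by (meson order.asym)
      qed
      with 3 show ?thesis by (auto simp: windows_def)
    qed (auto simp: windows_def)
  qed
  then show ?thesis by blast
qed

text \<open>The only possible new window ends at \<open>a\<close>. As \<open>a\<close> is the
  maximum, it is ascending as soon as the \<open>k - 1\<close> letters before \<open>a\<close>
  are.\<close>

lemma windows_snoc:
  assumes "\<forall>x\<in>set vs. x < a" and "k \<ge> 1"
  shows "windows k (vs @ [a]) = windows k vs \<union>
    (if k \<le> Suc (length vs) \<and> sorted_wrt (<) (drop (Suc (length vs) - k) vs)
     then {Suc (length vs) - k} else {})" (is "_ = _ \<union> ?E")
proof -
  have "i \<in> windows k (vs @ [a]) \<longleftrightarrow> i \<in> windows k vs \<union> ?E" for i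
  proof -
    consider "i + k \<le> length vs" | "i + k = Suc (length vs)" | "i + k > Suc (length vs)"
      by linarith
    then show ?thesis
    proof cases
      case 2
      then have "i = Suc (length vs) - k" "i \<le> length vs" "k - (length vs - i) = 1"
        "length vs - i \<le> k"
        using assms(2) by auto
      then show ?thesis
        using 2 assms(1)
        by (auto simp: windows_def sorted_wrt_append dest: in_set_dropD)
    qed (auto simp: windows_def)
  qed
  then show ?thesis by blast
qed

text \<open>An ascending suffix ending in the last letter \<open>?a\<close> may reach back through
  the word of \<open>v\<close>, but not into that of \<open>u\<close>, whose letters exceed
  \<open>?a\<close>. Thus \<open>last_run\<close> measures the longest ascending suffix.\<close>

lemma le_last_run_iff:
  "k \<le> last_run t \<longleftrightarrow> k \<le> nodes t \<and> sorted_wrt (<) (drop (nodes t - k) (word c t))"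
proof (induction t arbitrary: k c)
  case (Node u v)
  show ?case
  proof (cases k)
    case (Suc k')
    let ?a = "Suc (c + nodes v)"
    have drop: "drop (nodes (Node u v) - k) (word c (Node u v)) =
        drop (nodes u + nodes v - k') (word ?a u) @ drop (nodes v - k') (word c v) @ [?a]"
      if "k' \<le> nodes u + nodes v"
      using that by (auto simp: Suc)
    show ?thesis
    proof (cases "k' \<le> nodes v")
      case True
      then have "sorted_wrt (<) (drop (nodes (Node u v) - k) (word c (Node u v))) \<longleftrightarrow>
          sorted_wrt (<) (drop (nodes v - k') (word c v))"
        by (subst drop) (auto simp: sorted_wrt_append set_word dest!: in_set_dropD)
      then show ?thesis using True Node(2)[of k' c] by (simp add: Suc)
    next
      case False
      have "\<not> sorted_wrt (<) (drop (nodes (Node u v) - k) (word c (Node u v)))"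
        if le: "k' \<le> nodes u + nodes v"
      proof -
        have "drop (nodes u + nodes v - k') (word ?a u) \<noteq> []"
          using False le by auto
        then obtain x where x: "x \<in> set (drop (nodes u + nodes v - k') (word ?a u))"
          using hd_in_set by blast
        then have "?a < x" by (auto simp: set_word dest: in_set_dropD)
        with x show ?thesis
          by (subst drop[OF le]) (auto simp: sorted_wrt_append intro!: bexI[of _ x])
      qed
      then show ?thesis using False Node(2)[of k' c] by (auto simp: Suc)
    qed
  qed simp
qed simp

lemma card_windows_word:
  assumes "k \<ge> 1"
  shows "card (windows k (word c t)) = runs k t"
proof (induction t arbitrary: c)
  case Leaf
  then show ?case using assms by (simp add: windows_def)
next
  case (Node u v)
  let ?a = "Suc (c + nodes v)"
  let ?E = "if k \<le> Suc (last_run v) then {Suc (nodes v) - k} else {}"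
  \<comment> \<open>A window ending at \<open>?a\<close> uses \<open>k - 1\<close> letters of the
    word of \<open>v\<close>, so the criterion for \<open>last_run\<close> is taken at
    \<open>k - 1\<close>.\<close>
  have "k \<le> Suc (nodes v) \<and> sorted_wrt (<) (drop (Suc (nodes v) - k) (word c v)) \<longleftrightarrow>
      k \<le> Suc (last_run v)"
    using assms le_last_run_iff[of "k - 1" v c] by (cases k) auto
  then have "windows k (word c v @ [?a]) = windows k (word c v) \<union> ?E"
    using assms by (subst windows_snoc) (auto simp: set_word)
  moreover have "windows k (word c v) \<inter> ?E = {}"
    by (auto simp: windows_def)
  ultimately have V: "card (windows k (word c v @ [?a])) =
      runs k v + (if k \<le> Suc (last_run v) then 1 else 0)"
    using Node.IH(2)[of c] by (simp add: card_Un_disjoint finite_windows)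
  have "windows k (word c (Node u v)) =
      windows k (word ?a u) \<union> (\<lambda>i. nodes u + i) ` windows k (word c v @ [?a])"
    unfolding word.simps by (subst windows_append) (auto simp: set_word)
  \<comment> \<open>As \<open>k \<ge> 1\<close>, windows of the first block start before position
    \<open>nodes u\<close>.\<close>
  moreover have "windows k (word ?a u) \<inter> (\<lambda>i. nodes u + i) ` windows k (word c v @ [?a]) = {}"
    using assms by (auto simp: windows_def)
  ultimately show ?case
    using V Node.IH(1)[of ?a] by (simp add: card_Un_disjoint finite_windows card_image)
qed

text \<open>The map \<open>word 0\<close> is a bijection from trees to avoiders, and it turns
  \<open>runs k\<close> into the number of occurrences.\<close>

lemma card_perms_eq_card_trees:
  assumes "k \<ge> 1"
  shows "card {\<pi> \<in> permutations_of_set {1..n}. avoids \<pi> pat_1_3_2 \<and>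
           card (occurrences (pat_incr k) \<pi>) = m}
         = card {t. runs k t = m \<and> nodes t = n}"
proof -
  have "bij_betw (word 0) {t. runs k t = m \<and> nodes t = n}
      {\<pi> \<in> permutations_of_set {1..n}. avoids \<pi> pat_1_3_2 \<and>
         card (occurrences (pat_incr k) \<pi>) = m}"
    unfolding bij_betw_def
  proof (intro conjI)
    show "inj_on (word 0) {t. runs k t = m \<and> nodes t = n}"
      by (auto intro!: inj_onI dest: inj_word)
    show "word 0 ` {t. runs k t = m \<and> nodes t = n} = {\<pi> \<in> permutations_of_set {1..n}.
        avoids \<pi> pat_1_3_2 \<and> card (occurrences (pat_incr k) \<pi>) = m}" (is "_ = ?R")
    proof (intro equalityI subsetI)
      fix p assume "p \<in> ?R"
      then have p: "set p = {1..n}" "distinct p" "av132 p" "card (windows k p) = m"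
        using assms by (auto simp: permutations_of_set_def avoids_132_iff card_occurrences_pat_incr)
      then have "length p = n" using distinct_card by fastforce
      then obtain t where "nodes t = n" "word 0 t = p" using word_surj[of p 0] p by auto
      then show "p \<in> word 0 ` {t. runs k t = m \<and> nodes t = n}"
        using p(4) card_windows_word[OF assms, of 0 t] by auto
    qed (use assms in \<open>auto simp: permutations_of_set_def set_word distinct_word avoids_132_iff
           av132_word card_occurrences_pat_incr card_windows_word\<close>)
  qed
  then show ?thesis by (simp add: bij_betw_same_card)
qed

section \<open>Generating functions of classes of trees\<close>

definition tree_gf :: "ptree set \<Rightarrow> rat fps" where
  "tree_gf A = Abs_fps (\<lambda>n. of_nat (card {t \<in> A. nodes t = n}))"

text \<open>Both subtrees of a nonempty tree are smaller. The additivity of \<open>card\<close>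
  behind the rules for \<open>tree_gf\<close> rests on this finiteness.\<close>

lemma finite_nodes: "finite {t. nodes t = n}"
proof (induction n rule: less_induct)
  case (less n)
  have "{t. nodes t = n} \<subseteq> insert Leaf
     ((\<lambda>(u, v). Node u v) ` ((\<Union>i<n. {t. nodes t = i}) \<times> (\<Union>i<n. {t. nodes t = i})))"
  proof
    fix t assume "t \<in> {t. nodes t = n}"
    then show "t \<in> insert Leaf
     ((\<lambda>(u, v). Node u v) ` ((\<Union>i<n. {t. nodes t = i}) \<times> (\<Union>i<n. {t. nodes t = i})))"
      by (cases t) auto
  qed
  moreover have "finite (\<Union>i<n. {t. nodes t = i})" using less by auto
  ultimately show ?case by (meson finite_SigmaI finite_imageI finite_insert finite_subset)
qed

lemma tree_gf_UN:
  assumes "finite I" "\<And>i j. i \<in> I \<Longrightarrow> j \<in> I \<Longrightarrow> i \<noteq> j \<Longrightarrow> A i \<inter> A j = {}"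
  shows "tree_gf (\<Union>i\<in>I. A i) = (\<Sum>i\<in>I. tree_gf (A i))"
proof (rule fps_ext)
  fix n
  have "{t \<in> \<Union>i\<in>I. A i. nodes t = n} = (\<Union>i\<in>I. {t \<in> A i. nodes t = n})" by auto
  moreover have "card \<dots> = (\<Sum>i\<in>I. card {t \<in> A i. nodes t = n})"
    by (rule card_UN_disjoint) (use assms in \<open>auto intro: finite_subset[OF _ finite_nodes[of n]]\<close>)
  ultimately show "fps_nth (tree_gf (\<Union>i\<in>I. A i)) n = fps_nth (\<Sum>i\<in>I. tree_gf (A i)) n"
    by (simp add: tree_gf_def fps_sum_nth)
qed

lemma tree_gf_Un:
  assumes "A \<inter> B = {}"
  shows "tree_gf (A \<union> B) = tree_gf A + tree_gf B"
proof (rule fps_ext)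
  fix n
  have "{t \<in> A \<union> B. nodes t = n} = {t \<in> A. nodes t = n} \<union> {t \<in> B. nodes t = n}" by auto
  moreover have "card \<dots> = card {t \<in> A. nodes t = n} + card {t \<in> B. nodes t = n}"
    by (rule card_Un_disjoint) (use assms in \<open>auto intro: finite_subset[OF _ finite_nodes[of n]]\<close>)
  ultimately show "fps_nth (tree_gf (A \<union> B)) n = fps_nth (tree_gf A + tree_gf B) n"
    by (simp add: tree_gf_def)
qed

definition node_set :: "ptree set \<Rightarrow> ptree set \<Rightarrow> ptree set" where
  "node_set A B = (\<lambda>(u, v). Node u v) ` (A \<times> B)"

lemma Leaf_notin_node_set [simp]: "Leaf \<notin> node_set A B"
  by (auto simp: node_set_def)

lemma Node_in_node_set [simp]: "Node u v \<in> node_set A B \<longleftrightarrow> u \<in> A \<and> v \<in> B"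
  by (auto simp: node_set_def)

text \<open>The root accounts for \<open>fps_X\<close>; the remaining \<open>m\<close> nodes are
  shared between the subtrees as \<open>i\<close> and \<open>m - i\<close>, which is the Cauchy
  product.\<close>

lemma tree_gf_node_set: "tree_gf (node_set A B) = fps_X * tree_gf A * tree_gf B"
proof (rule fps_ext)
  fix n
  show "fps_nth (tree_gf (node_set A B)) n = fps_nth (fps_X * tree_gf A * tree_gf B) n"
  proof (cases n)
    case 0
    then show ?thesis by (auto simp: tree_gf_def node_set_def mult.assoc card_eq_0_iff)
  next
    case (Suc m)
    let ?S = "\<lambda>i. {u \<in> A. nodes u = i} \<times> {v \<in> B. nodes v = m - i}"
    have fin: "finite {t \<in> C. nodes t = i}" for C i
      by (rule finite_subset[OF _ finite_nodes[of i]]) auto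
    have "{t \<in> node_set A B. nodes t = n} = (\<lambda>(u, v). Node u v) ` (\<Union>i\<in>{0..m}. ?S i)"
      by (auto simp: node_set_def Suc image_iff)
    then have "card {t \<in> node_set A B. nodes t = n} = card (\<Union>i\<in>{0..m}. ?S i)"
      by (simp add: card_image inj_on_def split_beta prod_eq_iff)
    also have "\<dots> = (\<Sum>i=0..m. card (?S i))"
      by (rule card_UN_disjoint) (auto simp: fin)
    finally show ?thesis
      by (simp add: tree_gf_def Suc mult.assoc fps_mult_nth[of "Abs_fps _"] card_cartesian_product)
  qed
qed

lemma tree_gf_Leaf: "tree_gf {Leaf} = 1"
proof (rule fps_ext)
  fix n
  have "{t \<in> {Leaf}. nodes t = n} = (if n = 0 then {Leaf} else {})" by auto
  then show "fps_nth (tree_gf {Leaf}) n = fps_nth 1 n" by (simp add: tree_gf_def)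
qed

lemma tree_gf_empty [simp]: "tree_gf {} = 0"
  by (simp add: tree_gf_def fps_eq_iff)

section \<open>Decomposition by the length of the last run\<close>

context
  fixes k :: nat
  assumes k: "k \<ge> 1"
begin

definition cls :: "nat \<Rightarrow> nat \<Rightarrow> ptree set" where
  "cls m r = {t. runs k t = m \<and> last_run t = r}"

text \<open>A run of length \<open>r \<ge> k\<close> contains \<open>r + 1 - k\<close> windows; for
  shorter runs the truncated difference is 0. This bounds the last run by \<open>k - 1\<close> when
  there is no occurrence and by \<open>k\<close> when there is one.\<close>

lemma runs_ge_last_run: "last_run t + 1 - k \<le> runs k t"
  using k by (induction t) auto

lemma cls_0: "cls 0 0 = {Leaf}" "cls (Suc m) 0 = {}"
proof -
  have "t \<in> cls m 0 \<longleftrightarrow> t = Leaf \<and> m = 0" for t m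
    by (cases t) (auto simp: cls_def)
  then show "cls 0 0 = {Leaf}" "cls (Suc m) 0 = {}" by auto
qed

text \<open>The last run is shorter than \<open>k\<close>, so the root letter completes no window,
  and a single occurrence lies in exactly one of the two subtrees.\<close>

lemma cls_Suc:
  assumes "Suc r < k"
  shows "cls 0 (Suc r) = node_set {t. runs k t = 0} (cls 0 r)"
    and "cls 1 (Suc r) = node_set {t. runs k t = 1} (cls 0 r) \<union> node_set {t. runs k t = 0} (cls 1 r)"
proof -
  have "t \<in> cls 0 (Suc r) \<longleftrightarrow> t \<in> node_set {t. runs k t = 0} (cls 0 r)"
    "t \<in> cls 1 (Suc r) \<longleftrightarrow>
       t \<in> node_set {t. runs k t = 1} (cls 0 r) \<union> node_set {t. runs k t = 0} (cls 1 r)" for t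
    using assms by (cases t; auto simp: cls_def)+
  then show "cls 0 (Suc r) = node_set {t. runs k t = 0} (cls 0 r)"
    "cls 1 (Suc r) = node_set {t. runs k t = 1} (cls 0 r) \<union> node_set {t. runs k t = 0} (cls 1 r)"
    by blast+
qed

text \<open>The root letter completes a window, which must be the sole occurrence, so both subtrees
  have none.\<close>

lemma cls_1_k: "cls 1 k = node_set {t. runs k t = 0} (cls 0 (k - 1))"
proof -
  have "t \<in> cls 1 k \<longleftrightarrow> t \<in> node_set {t. runs k t = 0} (cls 0 (k - 1))" for t
    using k by (cases t) (auto simp: cls_def)
  then show ?thesis by blast
qed

lemma runs_0_eq: "{t. runs k t = 0} = (\<Union>r\<in>{0..k-1}. cls 0 r)"
proof -
  have "last_run t \<le> k - 1" if "runs k t = 0" for t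
    using runs_ge_last_run[of t] that by linarith
  then show ?thesis by (auto simp: cls_def)
qed

lemma runs_1_eq: "{t. runs k t = 1} = (\<Union>r\<in>{0..k-1}. cls 1 r) \<union> cls 1 k"
proof -
  have "last_run t \<le> k - 1 \<or> last_run t = k" if "runs k t = 1" for t
    using runs_ge_last_run[of t] that k by linarith
  then show ?thesis by (fastforce simp: cls_def)
qed

lemma tree_gf_cls_0:
  "r < k \<Longrightarrow> tree_gf (cls 0 r) = (fps_X * tree_gf {t. runs k t = 0}) ^ r"
  by (induction r) (auto simp: cls_0 tree_gf_Leaf cls_Suc tree_gf_node_set)

text \<open>Exactly one of the \<open>r\<close> blocks carries the occurrence: the factor
  \<open>r\<close> counts the choices, and the other \<open>r - 1\<close> blocks are
  avoiders.\<close>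

lemma tree_gf_cls_1:
  "r < k \<Longrightarrow> tree_gf (cls 1 r) =
     of_nat r * fps_X ^ r * tree_gf {t. runs k t = 1} * tree_gf {t. runs k t = 0} ^ (r - 1)"
proof (induction r)
  case 0
  then show ?case using cls_0(2)[of 0] by simp
next
  case (Suc r)
  let ?F = "tree_gf {t. runs k t = 0}" and ?G = "tree_gf {t. runs k t = 1}"
  have "node_set {t. runs k t = 1} (cls 0 r) \<inter> node_set {t. runs k t = 0} (cls 1 r) = {}"
    by (auto simp: node_set_def)
  then have "tree_gf (cls 1 (Suc r)) = fps_X * ?G * (fps_X * ?F) ^ r + fps_X * ?F * tree_gf (cls 1 r)"
    using Suc.prems by (simp only: cls_Suc tree_gf_Un tree_gf_node_set) (simp add: tree_gf_cls_0)
  \<comment> \<open>For \<open>r = 0\<close> the exponent \<open>r - 1\<close> is truncated, but the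
    factor \<open>of_nat r\<close> annihilates that term.\<close>
  also have "\<dots> = of_nat (Suc r) * fps_X ^ Suc r * ?G * ?F ^ r"
    using Suc by (cases r) (simp_all add: algebra_simps power_mult_distrib)
  finally show ?case by simp
qed

lemma tree_gf_cls_1_k: "tree_gf (cls 1 k) = fps_X ^ k * tree_gf {t. runs k t = 0} ^ k"
proof -
  \<comment> \<open>The exponent is written as \<open>Suc (k - 1)\<close> to separate the factor of
    the root and its block from the power for \<open>cls 0 (k - 1)\<close>.\<close>
  have "tree_gf (cls 1 k) = (fps_X * tree_gf {t. runs k t = 0}) ^ Suc (k - 1)"
    using k by (simp add: cls_1_k tree_gf_node_set tree_gf_cls_0 del: One_nat_def Suc_diff_1 Suc_pred)
  then show ?thesis using k by (simp add: power_mult_distrib)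
qed

lemma tree_gf_runs_0:
  "tree_gf {t. runs k t = 0} = (\<Sum>j=0..k-1. (fps_X * tree_gf {t. runs k t = 0}) ^ j)"
proof -
  have "tree_gf {t. runs k t = 0} = (\<Sum>j=0..k-1. tree_gf (cls 0 j))"
    by (subst runs_0_eq, rule tree_gf_UN) (auto simp: cls_def)
  also have "\<dots> = (\<Sum>j=0..k-1. (fps_X * tree_gf {t. runs k t = 0}) ^ j)"
    using k by (intro sum.cong refl tree_gf_cls_0) auto
  finally show ?thesis .
qed

lemma tree_gf_runs_1:
  "tree_gf {t. runs k t = 1} =
     (\<Sum>j=1..k-1. of_nat j * fps_X ^ j * tree_gf {t. runs k t = 1} * tree_gf {t. runs k t = 0} ^ (j - 1))
     + fps_X ^ k * tree_gf {t. runs k t = 0} ^ k"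
proof -
  let ?s = "\<lambda>j. of_nat j * fps_X ^ j * tree_gf {t. runs k t = 1} * tree_gf {t. runs k t = 0} ^ (j - 1)"
  have "tree_gf {t. runs k t = 1} = tree_gf (\<Union>r\<in>{0..k-1}. cls 1 r) + tree_gf (cls 1 k)"
    using k by (subst runs_1_eq, intro tree_gf_Un) (auto simp: cls_def)
  also have "tree_gf (\<Union>r\<in>{0..k-1}. cls 1 r) = (\<Sum>j=0..k-1. tree_gf (cls 1 j))"
    by (rule tree_gf_UN) (auto simp: cls_def)
  also have "\<dots> = (\<Sum>j=0..k-1. ?s j)"
    using k by (intro sum.cong refl tree_gf_cls_1) auto
  \<comment> \<open>The term for \<open>j = 0\<close> vanishes through its factor
    \<open>of_nat j\<close>.\<close>
  also have "\<dots> = (\<Sum>j=1..k-1. ?s j)"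
    by (simp add: sum.atLeast_Suc_atMost)
  finally show ?thesis by (simp only: tree_gf_cls_1_k)
qed

lemma F_gf_pat_incr: "F_gf (pat_incr k) = tree_gf {t. runs k t = 0}"
proof -
  \<comment> \<open>Finiteness ensures that cardinality 0 means that there is no occurrence.\<close>
  have "finite (occurrences (pat_incr k) p)" for p
    by (simp add: occurrences_pat_incr[OF k] finite_windows)
  then show ?thesis
    using card_perms_eq_card_trees[OF k, of _ 0]
    by (simp add: fps_eq_iff F_gf_def tree_gf_def f_count_def avoids_def[of _ "pat_incr k"])
qed

lemma G_gf_pat_incr: "G_gf (pat_incr k) = tree_gf {t. runs k t = 1}"
  using card_perms_eq_card_trees[OF k, of _ 1]
  by (simp add: fps_eq_iff G_gf_def tree_gf_def g_count_def contains_once_def)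

end

section \<open>Uniqueness of \<open>F\<close> and the conclusion\<close>

text \<open>Differences of powers make \<open>H - K\<close> a multiple of
  \<open>fps_X * (H - K)\<close>. The resulting cofactor \<open>1 - fps_X * Q\<close> has constant
  term 1, and an integral domain has no zero divisors.\<close>

lemma fps_geometric_fixpoint_unique:
  fixes H K :: "'a::idom fps"
  assumes "H = (\<Sum>j\<in>J. (fps_X * H) ^ j)" "K = (\<Sum>j\<in>J. (fps_X * K) ^ j)"
  shows "H = K"
proof -
  have "fps_X * H - fps_X * K dvd (\<Sum>j\<in>J. (fps_X * H) ^ j - (fps_X * K) ^ j)"
    by (intro dvd_sum) (metis power_diff_sumr2 dvd_triv_left)
  also have "\<dots> = H - K"
    using assms by (simp add: sum_subtractf)
  finally obtain Q where "H - K = (fps_X * H - fps_X * K) * Q" ..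
  then have "(H - K) * (1 - fps_X * Q) = 0" by (simp add: algebra_simps)
  moreover have "fps_nth (1 - fps_X * Q) 0 \<noteq> 0" by simp
  then have "1 - fps_X * Q \<noteq> 0" by (metis fps_zero_nth)
  ultimately show ?thesis by simp
qed

theorem theorem3p2:
  fixes k :: nat
  assumes "k \<ge> 1"
  shows "G_gf (pat_incr k) =
           (\<Sum>j=1..k-1. of_nat j * fps_X ^ j * G_gf (pat_incr k) * F_gf (pat_incr k) ^ (j - 1))
           + fps_X ^ k * F_gf (pat_incr k) ^ k
       \<and> F_gf (pat_incr k) = (\<Sum>j=0..k-1. (fps_X * F_gf (pat_incr k)) ^ j)
       \<and> (\<forall>H :: rat fps. H = (\<Sum>j=0..k-1. (fps_X * H) ^ j) \<longrightarrow> H = F_gf (pat_incr k))"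
  unfolding F_gf_pat_incr[OF assms] G_gf_pat_incr[OF assms]
  using tree_gf_runs_1[OF assms] tree_gf_runs_0[OF assms] fps_geometric_fixpoint_unique by blast

end
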